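(* Let $a,b$ be odd positive integers and $n$ a positive integer. Then $$t(a,a,2b,4b;n)=N(a,a,b,2b;4n+a+3b)-N\big(a,a,b,2b;2n+\tfrac{a+3b}2\big).$$
   Context: For positive integers $a_1,\dots,a_k$ and a nonnegative integer $n$, $N(a_1,\dots,a_k;n)$ is the number of $(x_1,\dots,x_k)\in\mathbb Z^k$ with $n=a_1x_1^2+\cdots+a_kx_k^2$, and $t(a_1,\dots,a_k;n)$ is the number of $(x_1,\dots,x_k)\in\mathbb Z^k$ with $n=a_1\frac{x_1(x_1-1)}2+\cdots+a_k\frac{x_k(x_k-1)}2$. *)

theory Defs
  imports Complex_Main
begin

definition num_sq_reps :: "nat list \<Rightarrow> nat \<Rightarrow> nat" where
  "num_sq_reps as n = card {xs :: int list. length xs = length as \<and>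
     int n = (\<Sum>i<length as. int (as ! i) * (xs ! i)\<^sup>2)}"

text \<open>The integer division below is exact, since \<open>x (x - 1)\<close> is always even. For lists
  of positive entries both sets of representations are finite, so \<open>card\<close> is a genuine count.\<close>

definition num_tri_reps :: "nat list \<Rightarrow> nat \<Rightarrow> nat" where
  "num_tri_reps as n = card {xs :: int list. length xs = length as \<and>
     int n = (\<Sum>i<length as. int (as ! i) * (xs ! i * (xs ! i - 1) div 2))}"

end

theory Submission
  imports Defs
begin

text \<open>Put M = 4 n + a + 3 b and split the representations
  M = a x^2 + a y^2 + b z^2 + 2 b w^2 by the parity of x + y.
  If x + y is even then z is even, and (x, y, z, w) = (u + v, u - v, 2 t, s) for a unique
  representation (u, v, s, t) of M / 2.
  If x + y is odd then z is odd, and reduction modulo 4 shows that w is odd; then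
  2 M = a (x + y)^2 + a (x - y)^2 + 2 b z^2 + 4 b w^2 with all four squares odd, and completing the
  square identifies such representations of 2 M = 8 n + 2 a + 6 b with those counted by
  \<open>num_tri_reps\<close>.\<close>

text \<open>Positive coefficients bound each entry: |x| \<le> x^2 \<le> a_i x^2 \<le> n. Finiteness
  is what later allows \<open>card\<close> to be added over the two parity classes.\<close>

lemma finite_sq_reps:
  assumes "\<And>a. a \<in> set as \<Longrightarrow> a > 0"
  shows "finite {xs :: int list. length xs = length as \<and>
     int n = (\<Sum>i<length as. int (as ! i) * (xs ! i)\<^sup>2)}" (is "finite ?S")
proof (rule finite_subset)
  show "?S \<subseteq> {xs. set xs \<subseteq> {- int n..int n} \<and> length xs = length as}"
  proof safe
    fix xs :: "int list" and x
    assume len: "length xs = length as" and x: "x \<in> set xs"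
      and n: "int n = (\<Sum>i<length as. int (as ! i) * (xs ! i)\<^sup>2)"
    from x len obtain i where i: "i < length as" "x = xs ! i"
      by (metis in_set_conv_nth)
    have "as ! i > 0"
      using assms i by simp
    have "\<bar>x\<bar> \<le> x\<^sup>2"
      using self_le_power[of "\<bar>x\<bar>" 2] by (cases "x = 0") auto
    also have "\<dots> \<le> int (as ! i) * x\<^sup>2"
      using \<open>as ! i > 0\<close> by (simp add: mult_le_cancel_right1)
    also have "\<dots> \<le> int n"
      unfolding n i(2) by (rule member_le_sum) (use i in auto)
    finally show "x \<in> {- int n..int n}"
      by auto
  qed
  show "finite {xs. set xs \<subseteq> {- int n..int n} \<and> length xs = length as}"
    by (rule finite_lists_length_eq) simp
qed

text \<open>Lists of length four are traded for tuples, so that the changes of variables below can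
  be written as maps on named coordinates.\<close>

definition quad_list :: "'a \<times> 'a \<times> 'a \<times> 'a \<Rightarrow> 'a list" where
  "quad_list = (\<lambda>(x, y, z, w). [x, y, z, w])"

lemma bij_betw_quad_list:
  "bij_betw quad_list {(x, y, z, w). P [x, y, z, w]} {xs. length xs = 4 \<and> P xs}"
proof (rule bij_betw_imageI)
  show "inj_on quad_list {(x, y, z, w). P [x, y, z, w]}"
    by (auto simp: inj_on_def quad_list_def)
  show "quad_list ` {(x, y, z, w). P [x, y, z, w]} = {xs. length xs = 4 \<and> P xs}"
    by (auto simp: quad_list_def image_iff numeral_eq_Suc length_Suc_conv)
qed

definition sq_quads :: "int \<Rightarrow> int \<Rightarrow> int \<Rightarrow> (int \<times> int \<times> int \<times> int) set" where
  "sq_quads a b m = {(x, y, z, w). m = a * x\<^sup>2 + a * y\<^sup>2 + b * z\<^sup>2 + 2 * b * w\<^sup>2}"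

definition tri_quads :: "int \<Rightarrow> int \<Rightarrow> int \<Rightarrow> (int \<times> int \<times> int \<times> int) set" where
  "tri_quads a b n = {(x, y, z, w). n = a * (x * (x - 1) div 2) + a * (y * (y - 1) div 2) +
     2 * b * (z * (z - 1) div 2) + 4 * b * (w * (w - 1) div 2)}"

lemma sum_lessThan_4:
  fixes f :: "nat \<Rightarrow> 'a::comm_monoid_add"
  shows "(\<Sum>i<4. f i) = f 0 + f 1 + f 2 + f 3"
  by (simp add: numeral_eq_Suc)

lemma sq_reps_bij:
  "bij_betw quad_list (sq_quads (int a) (int b) (int n))
     {xs :: int list. length xs = length [a, a, b, 2 * b] \<and>
       int n = (\<Sum>i<length [a, a, b, 2 * b]. int ([a, a, b, 2 * b] ! i) * (xs ! i)\<^sup>2)}"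
  using bij_betw_quad_list[of "\<lambda>xs. int n = (\<Sum>i<4. int ([a, a, b, 2 * b] ! i) * (xs ! i)\<^sup>2)"]
  by (simp add: sq_quads_def sum_lessThan_4 eval_nat_numeral)

lemma num_sq_reps_eq_card:
  "num_sq_reps [a, a, b, 2 * b] n = card (sq_quads (int a) (int b) (int n))"
  unfolding num_sq_reps_def using bij_betw_same_card[OF sq_reps_bij] by simp

lemma finite_sq_quads:
  assumes "a > 0" "b > 0"
  shows "finite (sq_quads (int a) (int b) (int n))"
  unfolding bij_betw_finite[OF sq_reps_bij] by (rule finite_sq_reps) (use assms in auto)

lemma num_tri_reps_eq_card:
  "num_tri_reps [a, a, 2 * b, 4 * b] n = card (tri_quads (int a) (int b) (int n))"
  using bij_betw_same_card[OF bij_betw_quad_list[of "\<lambda>xs. int n =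
    (\<Sum>i<4. int ([a, a, 2 * b, 4 * b] ! i) * (xs ! i * (xs ! i - 1) div 2))"]]
  by (simp add: num_tri_reps_def tri_quads_def sum_lessThan_4 eval_nat_numeral)

text \<open>Doubling the form preserves its shape: 2 (x^2 + y^2) = (x + y)^2 + (x - y)^2 and 2 (b
  z^2 + 2 b w^2) = b (2 w)^2 + 2 b z^2, which is why the last two coordinates change places.\<close>

lemma card_sq_quads_even:
  fixes a b m :: int
  assumes "odd a" "odd b"
  shows "card {(x, y, z, w) \<in> sq_quads a b (2 * m). even (x + y)} = card (sq_quads a b m)"
proof (rule sym, rule bij_betw_same_card)
  show "bij_betw (\<lambda>(x, y, z, w). (x + y, x - y, 2 * w, z)) (sq_quads a b m)
    {(x, y, z, w) \<in> sq_quads a b (2 * m). even (x + y)}"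
  proof (rule bij_betw_imageI)
    show "inj_on (\<lambda>(x, y, z, w). (x + y, x - y, 2 * w, z)) (sq_quads a b m)"
      by (auto simp: inj_on_def)
    show "(\<lambda>(x, y, z, w). (x + y, x - y, 2 * w, z)) ` sq_quads a b m =
      {(x, y, z, w) \<in> sq_quads a b (2 * m). even (x + y)}" (is "?f ` _ = ?R")
    proof
      show "?f ` sq_quads a b m \<subseteq> ?R"
        by (auto simp: sq_quads_def power2_eq_square algebra_simps)
      show "?R \<subseteq> ?f ` sq_quads a b m"
      proof clarify
        fix x y z w
        assume R: "(x, y, z, w) \<in> sq_quads a b (2 * m)" and xy: "even (x + y)"
        have eq: "2 * m = a * x\<^sup>2 + a * y\<^sup>2 + b * z\<^sup>2 + 2 * b * w\<^sup>2"
          using R by (simp add: sq_quads_def)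
        have "even (a * x\<^sup>2 + a * y\<^sup>2 + b * z\<^sup>2 + 2 * b * w\<^sup>2)"
          by (simp flip: eq)
        \<comment> \<open>x^2 + y^2 has the parity of x + y, so b z^2 is even, and b is odd.\<close>
        hence "even z"
          using assms xy by auto
        then obtain t where t: "z = 2 * t" ..
        from xy obtain u where u: "x + y = 2 * u" ..
        define v where "v = x - u"
        have x: "x = u + v" and y: "y = u - v"
          using u by (auto simp: v_def)
        have "m = a * u\<^sup>2 + a * v\<^sup>2 + b * w\<^sup>2 + 2 * b * t\<^sup>2"
          using eq unfolding x y t by (simp add: power2_eq_square algebra_simps)
        hence "(u, v, w, t) \<in> sq_quads a b m"
          by (simp add: sq_quads_def)
        thus "(x, y, z, w) \<in> ?f ` sq_quads a b m"
          by (rule rev_image_eqI) (simp add: x y t)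
      qed
    qed
  qed
qed

text \<open>Completing the square gives odd X = 2 x - 1 and Y = 2 y - 1 in a form with value 2 M.
  Their half-sum x + y - 1 and half-difference x - y satisfy (X^2 + Y^2) / 2 = (x + y - 1)^2 + (x -
  y)^2, which leads back to M itself.\<close>

lemma tri_quads_iff:
  "(x, y, z, w) \<in> tri_quads a b n \<longleftrightarrow>
     (x + y - 1, x - y, 2 * z - 1, 2 * w - 1) \<in> sq_quads a b (4 * n + a + 3 * b)"
proof -
  have tri: "2 * (k * (k - 1) div 2) = k * (k - 1)" for k :: int
    by simp
  define p q r s where "p = x * (x - 1) div 2" and "q = y * (y - 1) div 2"
    and "r = z * (z - 1) div 2" and "s = w * (w - 1) div 2"
  have sq: "(x + y - 1)\<^sup>2 + (x - y)\<^sup>2 = 4 * p + 4 * q + 1" "(2 * z - 1)\<^sup>2 = 8 * r + 1"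
    "(2 * w - 1)\<^sup>2 = 8 * s + 1"
    using tri[of x] tri[of y] tri[of z] tri[of w]
    unfolding p_def[symmetric] q_def[symmetric] r_def[symmetric] s_def[symmetric]
    by (auto simp: power2_eq_square algebra_simps)
  have "a * (x + y - 1)\<^sup>2 + a * (x - y)\<^sup>2 + b * (2 * z - 1)\<^sup>2 + 2 * b * (2 * w - 1)\<^sup>2 =
    4 * (a * p + a * q + 2 * b * r + 4 * b * s) + a + 3 * b"
    \<comment> \<open>\<open>sq(1)\<close> rewrites only the sum of the first two squares, so their
      common factor a is pulled out first.\<close>
    unfolding sq(2,3) distrib_left[symmetric] sq(1) by (simp add: algebra_simps)
  thus ?thesis
    by (auto simp: tri_quads_def sq_quads_def p_def q_def r_def s_def)
qed

text \<open>As a + 3 b is even and x^2 + y^2 is odd, z must be odd. Then x^2 + y^2 and z^2 are both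
  1 modulo 4, which leaves 2 b w^2 congruent to 2 b modulo 4.\<close>

lemma sq_quads_odd:
  fixes a b n :: int
  assumes "odd a" "odd b" "(x, y, z, w) \<in> sq_quads a b (4 * n + a + 3 * b)" "odd (x + y)"
  shows "odd z" "odd w"
proof -
  have eq: "4 * n + a + 3 * b = a * x\<^sup>2 + a * y\<^sup>2 + b * z\<^sup>2 + 2 * b * w\<^sup>2"
    using assms(3) by (simp add: sq_quads_def)
  have "even (4 * n + a + 3 * b)"
    using assms by simp
  thus "odd z"
    unfolding eq using assms by auto
  then obtain k where k: "z = 2 * k + 1" by (elim oddE)
  obtain u where u: "x + y = 2 * u + 1" using assms(4) by (elim oddE)
  define v where "v = x - u"
  have x: "x = u + v" and y: "y = u + 1 - v"
    using u by (auto simp: v_def)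
  \<comment> \<open>This is the equation with a + b cancelled and then halved.\<close>
  have "2 * n + b - a * (u\<^sup>2 + v\<^sup>2 + u - v) - 2 * b * (k\<^sup>2 + k) = b * w\<^sup>2"
    using eq unfolding x y k by (simp add: power2_eq_square algebra_simps)
  \<comment> \<open>The expression is u (u + 1) + v (v - 1).\<close>
  moreover have "even (u\<^sup>2 + v\<^sup>2 + u - v)"
    by auto
  ultimately have "odd (b * w\<^sup>2)"
    using assms(2) by (metis dvd_triv_left even_diff even_add even_mult_iff)
  thus "odd w" by auto
qed

lemma card_sq_quads_odd:
  fixes a b n :: int
  assumes "odd a" "odd b"
  shows "card {(x, y, z, w) \<in> sq_quads a b (4 * n + a + 3 * b). odd (x + y)} =
    card (tri_quads a b n)"
proof (rule sym, rule bij_betw_same_card)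
  show "bij_betw (\<lambda>(x, y, z, w). (x + y - 1, x - y, 2 * z - 1, 2 * w - 1)) (tri_quads a b n)
    {(x, y, z, w) \<in> sq_quads a b (4 * n + a + 3 * b). odd (x + y)}" (is "bij_betw ?f _ ?R")
  proof (rule bij_betw_imageI)
    show "inj_on ?f (tri_quads a b n)"
      by (auto simp: inj_on_def)
    show "?f ` tri_quads a b n = ?R"
    proof
      show "?f ` tri_quads a b n \<subseteq> ?R"
        \<comment> \<open>The first two image coordinates add up to 2 x - 1, which is odd.\<close>
        by (auto simp: tri_quads_iff)
      show "?R \<subseteq> ?f ` tri_quads a b n"
      proof clarify
        fix x y z w
        assume R: "(x, y, z, w) \<in> sq_quads a b (4 * n + a + 3 * b)" and xy: "odd (x + y)"
        from sq_quads_odd[OF assms R xy] have "even (z + 1)" "even (w + 1)" "even (x + y + 1)"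
          using xy by auto
        then obtain r s u where "z + 1 = 2 * r" "w + 1 = 2 * s" "x + y + 1 = 2 * u"
          by (elim evenE)
        \<comment> \<open>Solving X + Y - 1 = x and X - Y = y gives 2 X = x + y + 1, hence X = u and
          Y = u - y.\<close>
        hence eqs: "(x, y, z, w) = ?f (u, u - y, r, s)"
          by auto
        hence "(u, u - y, r, s) \<in> tri_quads a b n"
          using R by (simp add: tri_quads_iff)
        thus "(x, y, z, w) \<in> ?f ` tri_quads a b n"
          using eqs by (rule rev_image_eqI)
      qed
    qed
  qed
qed

theorem theorem5p9:
  fixes a b n :: nat
  assumes "a > 0" and "odd a" and "b > 0" and "odd b" and "n > 0"
  shows "int (num_tri_reps [a, a, 2 * b, 4 * b] n) =
    int (num_sq_reps [a, a, b, 2 * b] (4 * n + a + 3 * b)) -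
    int (num_sq_reps [a, a, b, 2 * b] (2 * n + (a + 3 * b) div 2))"
proof -
  define h where "h = 2 * n + (a + 3 * b) div 2"
  \<comment> \<open>The division in \<open>h\<close> is exact because a and b are both odd.\<close>
  have h: "4 * n + a + 3 * b = 2 * h"
    using assms by (simp add: h_def algebra_simps)
  let ?S = "sq_quads (int a) (int b) (int (4 * n + a + 3 * b))"
  let ?E = "{(x, y, z, w) \<in> ?S. even (x + y)}" and ?O = "{(x, y, z, w) \<in> ?S. odd (x + y)}"
  have fin: "finite ?S"
    using assms by (intro finite_sq_quads)
  have "card ?S = card (?E \<union> ?O)"
    by (rule arg_cong[of _ _ card]) auto
  also have "\<dots> = card ?E + card ?O"
    by (rule card_Un_disjoint) (auto intro: finite_subset[OF _ fin])
  also have "card ?E = card (sq_quads (int a) (int b) (int h))"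
    using card_sq_quads_even[of "int a" "int b" "int h"] assms by (simp add: h)
  also have "card ?O = card (tri_quads (int a) (int b) (int n))"
    using card_sq_quads_odd[of "int a" "int b" "int n"] assms by simp
  finally show ?thesis
    unfolding num_tri_reps_eq_card num_sq_reps_eq_card h_def[symmetric] by simp
qed

end
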